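(* For every $f\in\mathcal{H}$ we have $\widetilde{S(f)}=\tau\circ\widetilde f\circ\tau$ as linear maps on $\mathcal{A}_r$, where $S$ is the antipode of $\mathcal{H}$.
   Context: Fix $r\ge1$, $\mu_r$ the $r$th roots of unity, $\mathcal{A}_r=\mathbb{Q}\langle x,y_s\mid s\in\mu_r\rangle$ the free noncommutative polynomial algebra over $\mathbb{Q}$. Write $y=y_1$, $z=x+y_1$, $\delta(1)=0$, $\delta(s)=1$ for $s\ne1$, $z_s^\delta=x+\delta(s)y_s$. $\tau$ is the $\mathbb{Q}$-linear anti-automorphism of $\mathcal{A}_r$ with $\tau(x)=y_1$, $\tau(y_1)=x$, $\tau(y_s)=-y_s$ for $s\ne1$. $R_w$ denotes right multiplication by $w$, $R_w^{-1}$ removal of a final factor $w$. Rooted trees: $\mathcal{H}$ is the Connes–Kreimer Hopf algebra over $\mathbb{Q}$: the commutative polynomial algebra on (non-planar) rooted trees, with basis the rooted forests and unit the empty forest $\mathbb{I}$; $\bullet$ is the one-vertex tree. $B_+$ sends a forest to the tree obtained by attaching all its roots to a new root ($B_+(\mathbb{I})=\bullet$). The coproduct $\Delta$ is the algebra map with $\Delta(\mathbb{I})=\mathbb{I}\otimes\mathbb{I}$ and $\Delta(B_+(f))=B_+(f)\otimes\mathbb{I}+(\mathrm{id}\otimes B_+)\Delta(f)$; the counit kills nonempty forests; the antipode $S$ is the algebra anti-automorphism with $m(S\otimes\mathrm{id})\Delta=m(\mathrm{id}\otimes S)\Delta=\mathbb{I}\cdot\varepsilon$. Write $\Delta(f)=\sum_{(f)}f'\otimes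 f''$. Rooted tree maps: $\widetilde{\mathbb{I}}=\mathrm{id}$, and for each forest $f\ne\mathbb{I}$ the linear map $\widetilde{f}:\mathcal{A}_r\to\mathcal{A}_r$ is determined by $\widetilde f(1)=0$ and: (I) $\widetilde{\bullet}(z_s^\delta)=z_s^\delta(z-z_s^\delta)$, $\widetilde{\bullet}(z)=0$; (II) for a forest $f\ne\mathbb{I}$, $\widetilde{B_+(f)}(z_s^\delta)=R_{z-z_s^\delta}R_{2z-z_s^\delta}R_{z-z_s^\delta}^{-1}\widetilde f(z_s^\delta)$ and $\widetilde{B_+(f)}(z)=0$; (III) if $f=gh$, $\widetilde f(v)=\widetilde g(\widetilde h(v))$ for $v\in\{z,z_s^\delta\mid s\in\mu_r\}$; (IV) $\widetilde f(wv)=\sum_{(f)}\widetilde{f'}(w)\widetilde{f''}(v)$ for $w\in\mathcal{A}_r$, $v\in\{z,z_s^\delta\mid s\in\mu_r\}$. These are well defined and $f\mapsto\widetilde f$ extends linearly to an algebra homomorphism $\mathcal{H}\to\mathrm{End}_{\mathbb{Q}}(\mathcal{A}_r)$. *)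

theory Defs
  imports Complex_Main "HOL-Library.Poly_Mapping" "HOL-Library.Multiset" "HOL-Library.Product_Plus"
begin

definition scal :: "rat \<Rightarrow> ('a \<Rightarrow>\<^sub>0 rat) \<Rightarrow> ('a \<Rightarrow>\<^sub>0 rat)" where
  "scal c p = Poly_Mapping.map (\<lambda>a. c * a) p"

text \<open>Letters: x, and y_s for a complex number s (y_s belongs to A_r iff s^r = 1).\<close>
datatype letter = LX | LY complex

type_synonym alg = "letter list \<Rightarrow>\<^sub>0 rat"

definition valid_word :: "nat \<Rightarrow> letter list \<Rightarrow> bool" where
  "valid_word r w = (\<forall>l\<in>set w. case l of LX \<Rightarrow> True | LY s \<Rightarrow> s ^ r = 1)"

definition inA :: "nat \<Rightarrow> alg \<Rightarrow> bool" where
  "inA r p = (\<forall>w\<in>Poly_Mapping.keys p. valid_word r w)"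

definition amul :: "alg \<Rightarrow> alg \<Rightarrow> alg" where
  "amul p q = (\<Sum>a\<in>Poly_Mapping.keys p. \<Sum>b\<in>Poly_Mapping.keys q.
       Poly_Mapping.single (a @ b) (Poly_Mapping.lookup p a * Poly_Mapping.lookup q b))"

definition aone :: alg where "aone = Poly_Mapping.single [] 1"

definition gen :: "letter \<Rightarrow> alg" where "gen l = Poly_Mapping.single [l] 1"

definition xx :: alg where "xx = gen LX"
definition yy :: "complex \<Rightarrow> alg" where "yy s = gen (LY s)"
definition zz :: alg where "zz = xx + yy 1"

definition delta :: "complex \<Rightarrow> rat" where "delta s = (if s = 1 then 0 else 1)"

definition zd :: "complex \<Rightarrow> alg" where "zd s = xx + scal (delta s) (yy s)"

text \<open>tau: the anti-automorphism with x -> y_1, y_1 -> x, y_s -> -y_s (s /= 1).\<close>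
fun tau_letter :: "letter \<Rightarrow> letter" where
  "tau_letter LX = LY 1"
| "tau_letter (LY s) = (if s = 1 then LX else LY s)"

fun tau_sign :: "letter \<Rightarrow> rat" where
  "tau_sign LX = 1"
| "tau_sign (LY s) = (if s = 1 then 1 else -1)"

definition tau_word :: "letter list \<Rightarrow> alg" where
  "tau_word w = Poly_Mapping.single (rev (map tau_letter w)) (\<Prod>l\<leftarrow>w. tau_sign l)"

definition tau :: "alg \<Rightarrow> alg" where
  "tau p = (\<Sum>w\<in>Poly_Mapping.keys p. scal (Poly_Mapping.lookup p w) (tau_word w))"

text \<open>Non-planar rooted trees: a root with a multiset of subtrees. Forests are multisets of trees;
  the product of forests is multiset union and the empty forest is the unit.\<close>
datatype tree = Node "tree multiset"

type_synonym forest = "tree multiset"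

text \<open>H = Q-linear combinations of forests (the polynomial algebra on trees, as a monoid algebra).\<close>
type_synonym hopf = "forest \<Rightarrow>\<^sub>0 rat"

text \<open>H tensor H = Q-linear combinations of pairs of forests.\<close>
type_synonym hopf2 = "(forest \<times> forest) \<Rightarrow>\<^sub>0 rat"

definition Bplus :: "forest \<Rightarrow> tree" where "Bplus f = Node f"

definition bullet :: tree where "bullet = Node {#}"

definition id_Bplus :: "hopf2 \<Rightarrow> hopf2" where
  "id_Bplus p = (\<Sum>k\<in>Poly_Mapping.keys p.
      Poly_Mapping.single (fst k, {#Bplus (snd k)#}) (Poly_Mapping.lookup p k))"

primrec cop_tree :: "tree \<Rightarrow> hopf2" where
  "cop_tree (Node f) = Poly_Mapping.single ({#Node f#}, {#}) 1
      + id_Bplus (prod_mset (image_mset cop_tree f))"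

definition cop_forest :: "forest \<Rightarrow> hopf2" where
  "cop_forest f = prod_mset (image_mset cop_tree f)"

definition coproduct :: "hopf \<Rightarrow> hopf2" where
  "coproduct h = (\<Sum>f\<in>Poly_Mapping.keys h. scal (Poly_Mapping.lookup h f) (cop_forest f))"

definition counit :: "hopf \<Rightarrow> rat" where
  "counit h = Poly_Mapping.lookup h {#}"

definition forest :: "forest \<Rightarrow> hopf" where "forest f = Poly_Mapping.single f 1"

definition m_S_id :: "(hopf \<Rightarrow> hopf) \<Rightarrow> hopf2 \<Rightarrow> hopf" where
  "m_S_id S p = (\<Sum>k\<in>Poly_Mapping.keys p.
      scal (Poly_Mapping.lookup p k) (S (forest (fst k)) * forest (snd k)))"

definition m_id_S :: "(hopf \<Rightarrow> hopf) \<Rightarrow> hopf2 \<Rightarrow> hopf" where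
  "m_id_S S p = (\<Sum>k\<in>Poly_Mapping.keys p.
      scal (Poly_Mapping.lookup p k) (forest (fst k) * S (forest (snd k))))"

definition is_antipode :: "(hopf \<Rightarrow> hopf) \<Rightarrow> bool" where
  "is_antipode S \<longleftrightarrow>
     (\<forall>a b. S (a + b) = S a + S b) \<and> (\<forall>c a. S (scal c a) = scal c (S a)) \<and>
     (\<forall>a b. S (a * b) = S b * S a) \<and> S 1 = 1 \<and> bij S \<and>
     (\<forall>h. m_S_id S (coproduct h) = scal (counit h) 1) \<and>
     (\<forall>h. m_id_S S (coproduct h) = scal (counit h) 1)"

text \<open>T f is the rooted tree map of the forest f, as a linear map on A_r.
  The conditions below are (I)--(IV) of the paper, together with linearity,
  T(empty forest) = id and T f (1) = 0 for f nonempty.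
  R_w^{-1} (removal of a final factor w) is expressed by writing T f (z_s^delta) = q w.\<close>
definition is_rtm :: "nat \<Rightarrow> (forest \<Rightarrow> alg \<Rightarrow> alg) \<Rightarrow> bool" where
  "is_rtm r T \<longleftrightarrow>
     (\<forall>f a b. T f (a + b) = T f a + T f b) \<and>
     (\<forall>f c a. T f (scal c a) = scal c (T f a)) \<and>
     T {#} = id \<and>
     (\<forall>f. f \<noteq> {#} \<longrightarrow> T f aone = 0) \<and>
     \<comment> \<open>(I)\<close>
     (\<forall>s. s ^ r = 1 \<longrightarrow> T {#bullet#} (zd s) = amul (zd s) (zz - zd s)) \<and>
     T {#bullet#} zz = 0 \<and>
     \<comment> \<open>(II)\<close>
     (\<forall>f s. f \<noteq> {#} \<longrightarrow> s ^ r = 1 \<longrightarrow>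
        (\<exists>q. T f (zd s) = amul q (zz - zd s) \<and>
             T {#Bplus f#} (zd s) = amul (amul q (zz + zz - zd s)) (zz - zd s))) \<and>
     (\<forall>f. f \<noteq> {#} \<longrightarrow> T {#Bplus f#} zz = 0) \<and>
     \<comment> \<open>(III)\<close>
     (\<forall>g h. g \<noteq> {#} \<longrightarrow> h \<noteq> {#} \<longrightarrow>
        T (g + h) zz = T g (T h zz) \<and>
        (\<forall>s. s ^ r = 1 \<longrightarrow> T (g + h) (zd s) = T g (T h (zd s)))) \<and>
     \<comment> \<open>(IV)\<close>
     (\<forall>f w v. f \<noteq> {#} \<longrightarrow> inA r w \<longrightarrow> (v = zz \<or> (\<exists>s. s ^ r = 1 \<and> v = zd s)) \<longrightarrow>
        T f (amul w v) = (\<Sum>k\<in>Poly_Mapping.keys (cop_forest f).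
            scal (Poly_Mapping.lookup (cop_forest f) k) (amul (T (fst k) w) (T (snd k) v))))"

definition rtm_lin :: "(forest \<Rightarrow> alg \<Rightarrow> alg) \<Rightarrow> hopf \<Rightarrow> alg \<Rightarrow> alg" where
  "rtm_lin T h v = (\<Sum>f\<in>Poly_Mapping.keys h. scal (Poly_Mapping.lookup h f) (T f v))"

end

theory Submission
  imports Defs
begin

text \<open>
  Write \<open>a = z\<^sub>s\<^sup>\<delta>\<close> and \<open>b = z - a\<close>, so that \<open>\<tau>\<close> fixes \<open>z\<close> and exchanges \<open>a\<close> and \<open>b\<close>. The maps
  \<open>T f\<close> make the algebra a module algebra over the Hopf algebra of forests. Their values on \<open>a\<close>
  satisfy the closed recursion
  \[ T f(a) = \varepsilon(f)\, a - \sum_{(f)} T f'(a)\, w(f'')\, b, \]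
  where \<open>w(f) = (-1)\<^sup>l z\<^sup>n\<^sup>-\<^sup>1\<close> for a nonempty forest with \<open>l\<close> leaves and \<open>n\<close> vertices, and
  \<open>w\<close> vanishes on the empty forest. Applying \<open>\<tau>\<close> to this recursion and using coassociativity shows
  that \<open>L f = \<tau> \<circ> T f \<circ> \<tau>\<close> satisfies \<open>\<Sum> T f' \<circ> L f'' = \<epsilon>(f)\<close> on \<open>a\<close>; the identity is trivial on
  \<open>z\<close> and passes to products. Hence \<open>L\<close> is a right convolution inverse of \<open>T\<close>. Since the antipode
  provides a left convolution inverse, the two coincide.
\<close>

text \<open>With this instance \<^const>\<open>amul\<close> becomes the ring multiplication of \<^type>\<open>poly_mapping\<close>.\<close>
instantiation list :: (type) monoid_add
begin
definition zero_list_def: "0 = []"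
definition plus_list_def: "xs + ys = xs @ ys"
instance by standard (simp_all add: zero_list_def plus_list_def)
end

section \<open>Rational linear algebra on finitely supported functions\<close>

lemma lookup_scal [simp]: "Poly_Mapping.lookup (scal c p) k = c * Poly_Mapping.lookup p k"
  by (simp add: scal_def Poly_Mapping.map.rep_eq when_def)

lemma scal_add_right: "scal c (p + q) = scal c p + scal c q"
  by (rule poly_mapping_eqI) (simp add: lookup_add algebra_simps)

lemma scal_diff_right: "scal c (p - q) = scal c p - scal c q"
  by (rule poly_mapping_eqI) (simp add: lookup_minus algebra_simps)

lemma scal_add_left: "scal (c + d) p = scal c p + scal d p"
  by (rule poly_mapping_eqI) (simp add: lookup_add algebra_simps)

lemma scal_scal [simp]: "scal c (scal d p) = scal (c * d) p"
  by (rule poly_mapping_eqI) simp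

lemma scal_one [simp]: "scal 1 p = p"
  by (rule poly_mapping_eqI) simp

lemma scal_zero_left [simp]: "scal 0 p = 0"
  by (rule poly_mapping_eqI) simp

lemma scal_zero_right [simp]: "scal c 0 = 0"
  by (rule poly_mapping_eqI) simp

lemma scal_minus_one: "scal (- 1) p = - p"
  by (rule poly_mapping_eqI) simp

lemma scal_single [simp]: "scal c (Poly_Mapping.single k d) = Poly_Mapping.single k (c * d)"
  by (rule poly_mapping_eqI) (simp add: lookup_single when_def)

lemma scal_sum: "scal c (sum f A) = (\<Sum>i\<in>A. scal c (f i))"
  by (induction A rule: infinite_finite_induct) (simp_all add: scal_add_right)

lemma scal_eq_times: "scal c p = Poly_Mapping.single 0 c * p"
  for p :: "'a::monoid_add \<Rightarrow>\<^sub>0 rat"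
  by (simp add: scal_def mult_map_scale_conv_mult)

lemma scal_mult_left: "scal c p * q = scal c (p * q)"
  for p :: "'a::monoid_add \<Rightarrow>\<^sub>0 rat"
  by (simp add: scal_eq_times mult.assoc)

definition qlin :: "(('a \<Rightarrow>\<^sub>0 rat) \<Rightarrow> ('b \<Rightarrow>\<^sub>0 rat)) \<Rightarrow> bool" where
  "qlin L \<longleftrightarrow> (\<forall>p q. L (p + q) = L p + L q) \<and> (\<forall>c p. L (scal c p) = scal c (L p))"

lemma qlinI:
  assumes "\<And>p q. L (p + q) = L p + L q" and "\<And>c p. L (scal c p) = scal c (L p)"
  shows "qlin L"
  using assms by (simp add: qlin_def)

lemma qlin_add: "qlin L \<Longrightarrow> L (p + q) = L p + L q"
  and qlin_scal: "qlin L \<Longrightarrow> L (scal c p) = scal c (L p)"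
  by (simp_all add: qlin_def)

lemma qlin_zero: "qlin L \<Longrightarrow> L 0 = 0"
  using qlin_scal [of L 0 0] by simp

lemma qlin_minus: "qlin L \<Longrightarrow> L (- p) = - L p"
  using qlin_scal [of L "- 1" p] by (simp add: scal_minus_one)

lemma qlin_diff: "qlin L \<Longrightarrow> L (p - q) = L p - L q"
  using qlin_add [of L p "- q"] by (simp add: qlin_minus)

lemma qlin_sum: "qlin L \<Longrightarrow> L (sum f A) = (\<Sum>i\<in>A. L (f i))"
  by (induction A rule: infinite_finite_induct) (simp_all add: qlin_zero qlin_add)

text \<open>The value at \<open>p\<close> of the linear map that sends the basis vector of
  \<open>k\<close> to \<open>F k\<close>. Coproduct sums, \<open>tau\<close> and the maps of general
  Hopf algebra elements are all written this way.\<close>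

definition lsum :: "('a \<Rightarrow>\<^sub>0 rat) \<Rightarrow> ('a \<Rightarrow> ('b \<Rightarrow>\<^sub>0 rat)) \<Rightarrow> ('b \<Rightarrow>\<^sub>0 rat)" where
  "lsum p F = (\<Sum>k\<in>Poly_Mapping.keys p. scal (Poly_Mapping.lookup p k) (F k))"

lemma lsum_superset:
  assumes "finite A" "Poly_Mapping.keys p \<subseteq> A"
  shows "lsum p F = (\<Sum>k\<in>A. scal (Poly_Mapping.lookup p k) (F k))"
  unfolding lsum_def by (rule sum.mono_neutral_left) (use assms in \<open>auto simp: in_keys_iff\<close>)

lemma lsum_cong: "(\<And>k. k \<in> Poly_Mapping.keys p \<Longrightarrow> F k = G k) \<Longrightarrow> lsum p F = lsum p G"
  by (simp add: lsum_def)

lemma qlin_lsum_left: "qlin (\<lambda>p. lsum p F)"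
proof (rule qlinI)
  fix p q :: "'a \<Rightarrow>\<^sub>0 rat" and c :: rat
  let ?A = "Poly_Mapping.keys p \<union> Poly_Mapping.keys q"
  have "Poly_Mapping.keys (p + q) \<subseteq> ?A" by (rule Poly_Mapping.keys_add)
  then show "lsum (p + q) F = lsum p F + lsum q F"
    by (simp add: lsum_superset [of ?A] lookup_add scal_add_left sum.distrib)
  have "Poly_Mapping.keys (scal c p) \<subseteq> Poly_Mapping.keys p" by (auto simp: in_keys_iff)
  then show "lsum (scal c p) F = scal c (lsum p F)"
    by (simp add: lsum_superset [of "Poly_Mapping.keys p"] scal_sum)
qed

lemma lsum_single [simp]: "lsum (Poly_Mapping.single k c) F = scal c (F k)"
  by (cases "c = 0") (simp_all add: lsum_def)

lemma lsum_add_left: "lsum (p + q) F = lsum p F + lsum q F"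
  by (rule qlin_add [OF qlin_lsum_left])

lemma qlin_lsum: "qlin L \<Longrightarrow> L (lsum p F) = lsum p (\<lambda>k. L (F k))"
  by (simp add: lsum_def qlin_sum qlin_scal)

lemma lsum_lsum: "lsum (lsum p F) G = lsum p (\<lambda>k. lsum (F k) G)"
  by (rule qlin_lsum [OF qlin_lsum_left])

lemma lsum_singles: "lsum p (\<lambda>k. Poly_Mapping.single k 1) = p"
proof (rule poly_mapping_eqI)
  fix j
  show "Poly_Mapping.lookup (lsum p (\<lambda>k. Poly_Mapping.single k 1)) j = Poly_Mapping.lookup p j"
    by (simp add: lsum_def lookup_sum lookup_single when_def in_keys_iff)
qed

lemma qlin_expand: "qlin L \<Longrightarrow> L p = lsum p (\<lambda>k. L (Poly_Mapping.single k 1))"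
  using qlin_lsum [of L p "\<lambda>k. Poly_Mapping.single k 1"] by (simp add: lsum_singles)

lemma lsum_add: "lsum p (\<lambda>k. F k + G k) = lsum p F + lsum p G"
  by (simp add: lsum_def scal_add_right sum.distrib)

lemma lsum_scal: "lsum p (\<lambda>k. scal c (F k)) = scal c (lsum p F)"
  by (simp add: lsum_def scal_sum mult.commute)

lemma lsum_swap: "lsum p (\<lambda>a. lsum q (\<lambda>b. F a b)) = lsum q (\<lambda>b. lsum p (\<lambda>a. F a b))"
  unfolding lsum_def scal_sum scal_scal by (subst sum.swap) (simp add: mult.commute)

lemma qlin_times_left: "qlin (\<lambda>p. p * q)" for q :: "'a::monoid_add \<Rightarrow>\<^sub>0 rat"
  by (simp add: qlin_def distrib_right scal_mult_left)

text \<open>Words do not commute, but scalars sit at the neutral element \<open>0\<close>, which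
  commutes with every basis element.\<close>

lemma single_zero_commute: "p * Poly_Mapping.single 0 c = Poly_Mapping.single 0 c * p"
  for p :: "'a::monoid_add \<Rightarrow>\<^sub>0 rat"
proof -
  have "p * Poly_Mapping.single 0 c = lsum p (\<lambda>k. Poly_Mapping.single k 1 * Poly_Mapping.single 0 c)"
    by (rule qlin_expand [OF qlin_times_left])
  also have "\<dots> = lsum p (\<lambda>k. scal c (Poly_Mapping.single k 1))"
    by (simp add: mult_single)
  also have "\<dots> = scal c p"
    by (simp only: lsum_scal lsum_singles)
  finally show ?thesis by (simp add: scal_eq_times)
qed

lemma scal_mult_right: "p * scal c q = scal c (p * q)"
  for p :: "'a::monoid_add \<Rightarrow>\<^sub>0 rat"
  by (simp add: scal_eq_times mult.assoc [symmetric] single_zero_commute)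

lemma qlin_times_right: "qlin (\<lambda>q. p * q)" for p :: "'a::monoid_add \<Rightarrow>\<^sub>0 rat"
  by (simp add: qlin_def distrib_left scal_mult_right)

lemma times_eq_lsum: "p * q = lsum p (\<lambda>a. lsum q (\<lambda>b. Poly_Mapping.single (a + b) 1))"
  for p :: "'a::monoid_add \<Rightarrow>\<^sub>0 rat"
proof -
  have "Poly_Mapping.single a 1 * q = lsum q (\<lambda>b. Poly_Mapping.single (a + b) 1)" for a
    by (subst qlin_expand [OF qlin_times_right]) (simp add: mult_single)
  then show ?thesis
    by (subst qlin_expand [OF qlin_times_left]) simp
qed

lemma lsum_times: "lsum (p * q) F = lsum p (\<lambda>a. lsum q (\<lambda>b. F (a + b)))"
  for p :: "'a::monoid_add \<Rightarrow>\<^sub>0 rat"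
  by (simp add: times_eq_lsum lsum_lsum)

lemma amul_eq_times: "amul p q = p * q"
  by (simp add: amul_def times_eq_lsum lsum_def scal_sum plus_list_def)

lemma aone_eq_one: "aone = 1"
  by (simp add: aone_def zero_list_def flip: single_one)

section \<open>Forests: induction, size and coproduct sums\<close>

lemma forest_induct [case_names empty Node plus]:
  assumes "P {#}"
    and "\<And>f. P f \<Longrightarrow> P {#Node f#}"
    and "\<And>f g. f \<noteq> {#} \<Longrightarrow> g \<noteq> {#} \<Longrightarrow> P f \<Longrightarrow> P g \<Longrightarrow> P (f + g)"
  shows "P f"
proof -
  \<comment> \<open>Trees nest inside multisets, so tree induction yields \<open>P {#t#}\<close> for
    the children only; this assembles those facts into \<open>P\<close> for the forest of
    children.\<close>
  have *: "P f" if "\<And>t. t \<in># f \<Longrightarrow> P {#t#}" for f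
    using that
  proof (induction f)
    case empty
    show ?case by (rule assms(1))
  next
    case (add t f)
    then have "P {#t#}" "P f" by simp_all
    then show ?case
      using assms(3) [of f "{#t#}"] by (cases "f = {#}") simp_all
  qed
  have "P {#t#}" for t
    by (induction t) (blast intro: assms(2) *)
  then show ?thesis by (rule *)
qed

lemma forest_cases [case_names empty Node plus]:
  obtains "f = {#}" | g where "f = {#Node g#}" | g h where "f = g + h" "g \<noteq> {#}" "h \<noteq> {#}"
  by (induction f rule: forest_induct) auto

primrec tree_size :: "tree \<Rightarrow> nat" where
  "tree_size (Node f) = Suc (sum_mset (image_mset tree_size f))"

definition forest_size :: "forest \<Rightarrow> nat" where
  "forest_size f = sum_mset (image_mset tree_size f)"

lemma forest_size_empty [simp]: "forest_size {#} = 0"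
  and forest_size_Node [simp]: "forest_size {#Node f#} = Suc (forest_size f)"
  and forest_size_plus [simp]: "forest_size (f + g) = forest_size f + forest_size g"
  by (simp_all add: forest_size_def)

lemma forest_size_eq_0_iff [simp]: "forest_size f = 0 \<longleftrightarrow> f = {#}"
  by (induction f rule: forest_induct) auto

text \<open>In Sweedler notation, the sum over \<open>(f)\<close> of \<open>F f' f''\<close>.\<close>
definition cop_sum :: "forest \<Rightarrow> (forest \<Rightarrow> forest \<Rightarrow> ('b \<Rightarrow>\<^sub>0 rat)) \<Rightarrow> ('b \<Rightarrow>\<^sub>0 rat)" where
  "cop_sum f F = lsum (cop_forest f) (\<lambda>k. F (fst k) (snd k))"

lemma id_Bplus_eq_lsum:
  "id_Bplus p = lsum p (\<lambda>k. Poly_Mapping.single (fst k, {#Node (snd k)#}) 1)"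
  by (simp add: id_Bplus_def lsum_def Bplus_def)

lemma cop_forest_empty: "cop_forest {#} = Poly_Mapping.single ({#}, {#}) 1"
  unfolding cop_forest_def by (simp add: zero_prod_def flip: single_one)

lemma cop_forest_Node:
  "cop_forest {#Node f#} = Poly_Mapping.single ({#Node f#}, {#}) 1 + id_Bplus (cop_forest f)"
  by (simp add: cop_forest_def)

lemma cop_forest_plus: "cop_forest (f + g) = cop_forest f * cop_forest g"
  by (simp add: cop_forest_def)

lemma cop_sum_empty [simp]: "cop_sum {#} F = F {#} {#}"
  by (simp add: cop_sum_def cop_forest_empty)

lemma cop_sum_Node: "cop_sum {#Node f#} F = F {#Node f#} {#} + cop_sum f (\<lambda>x y. F x {#Node y#})"
  by (simp add: cop_sum_def cop_forest_Node lsum_add_left id_Bplus_eq_lsum lsum_lsum)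

lemma cop_sum_plus:
  "cop_sum (f + g) F = cop_sum f (\<lambda>x y. cop_sum g (\<lambda>x' y'. F (x + x') (y + y')))"
  by (simp add: cop_sum_def cop_forest_plus lsum_times)

text \<open>The coproduct is graded by the number of vertices, which bounds both Sweedler factors in
  the later inductions on size.\<close>

lemma cop_forest_keys_size:
  "k \<in> Poly_Mapping.keys (cop_forest f) \<Longrightarrow> forest_size (fst k) + forest_size (snd k) = forest_size f"
proof (induction f arbitrary: k rule: forest_induct)
  case empty
  then show ?case by (simp add: cop_forest_empty)
next
  case (Node f)
  have "Poly_Mapping.keys (id_Bplus (cop_forest f))
      \<subseteq> (\<Union>j\<in>Poly_Mapping.keys (cop_forest f). {(fst j, {#Node (snd j)#})})"
    unfolding id_Bplus_def Bplus_def by (rule order.trans [OF keys_sum]) (auto split: if_splits)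
  moreover have "Poly_Mapping.keys (cop_forest {#Node f#})
      \<subseteq> {({#Node f#}, {#})} \<union> Poly_Mapping.keys (id_Bplus (cop_forest f))"
    unfolding cop_forest_Node by (rule order.trans [OF Poly_Mapping.keys_add]) simp
  ultimately consider "k = ({#Node f#}, {#})"
    | j where "j \<in> Poly_Mapping.keys (cop_forest f)" "k = (fst j, {#Node (snd j)#})"
    using Node.prems by blast
  then show ?case
  proof cases
    case 1
    then show ?thesis by simp
  next
    case (2 j)
    then show ?thesis using Node.IH [of j] by simp
  qed
next
  case (plus f g)
  have "k \<in> {a + b |a b. a \<in> Poly_Mapping.keys (cop_forest f) \<and> b \<in> Poly_Mapping.keys (cop_forest g)}"
    using plus.prems keys_mult [of "cop_forest f" "cop_forest g"]
    unfolding cop_forest_plus by (rule rev_subsetD)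
  then obtain a b where "k = a + b" "a \<in> Poly_Mapping.keys (cop_forest f)"
    "b \<in> Poly_Mapping.keys (cop_forest g)" by blast
  then show ?case using plus.IH(1) [of a] plus.IH(2) [of b] by simp
qed

lemma cop_sum_cong_size:
  assumes "\<And>x y. forest_size x + forest_size y = forest_size f \<Longrightarrow> F x y = G x y"
  shows "cop_sum f F = cop_sum f G"
  unfolding cop_sum_def by (rule lsum_cong) (use assms cop_forest_keys_size in blast)

lemma qlin_cop_sum: "qlin L \<Longrightarrow> L (cop_sum f F) = cop_sum f (\<lambda>x y. L (F x y))"
  by (simp add: cop_sum_def qlin_lsum)

lemma cop_sum_add: "cop_sum f (\<lambda>x y. F x y + G x y) = cop_sum f F + cop_sum f G"
  by (simp add: cop_sum_def lsum_add)

lemma cop_sum_minus: "cop_sum f (\<lambda>x y. - F x y) = - cop_sum f F"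
  using lsum_scal [of "cop_forest f" "- 1" "\<lambda>k. F (fst k) (snd k)"]
  by (simp add: cop_sum_def scal_minus_one)

lemma cop_sum_diff: "cop_sum f (\<lambda>x y. F x y - G x y) = cop_sum f F - cop_sum f G"
  using cop_sum_add [of f F "\<lambda>x y. - G x y"] by (simp add: cop_sum_minus)

lemma cop_sum_mult_left: "p * cop_sum f F = cop_sum f (\<lambda>x y. p * F x y)"
  for p :: "'a::monoid_add \<Rightarrow>\<^sub>0 rat"
  by (rule qlin_cop_sum [OF qlin_times_right])

lemma cop_sum_mult_right: "cop_sum f F * p = cop_sum f (\<lambda>x y. F x y * p)"
  for p :: "'a::monoid_add \<Rightarrow>\<^sub>0 rat"
  by (rule qlin_cop_sum [OF qlin_times_left])

section \<open>Coassociativity and counit laws\<close>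

lemma cop_sum_swap:
  "cop_sum f (\<lambda>x y. cop_sum g (\<lambda>x' y'. F x y x' y')) = cop_sum g (\<lambda>x' y'. cop_sum f (\<lambda>x y. F x y x' y'))"
  unfolding cop_sum_def by (rule lsum_swap)

text \<open>For a tree, both sides share the terms whose root lies in the first or second of the
  three factors, and the rest is the induction hypothesis. For a product, the sums over the two
  forests are interchanged.\<close>

lemma cop_sum_coassoc:
  "cop_sum f (\<lambda>u z. cop_sum u (\<lambda>x y. F x y z)) = cop_sum f (\<lambda>x u. cop_sum u (\<lambda>y z. F x y z))"
proof (induction f arbitrary: F rule: forest_induct)
  case empty
  show ?case by simp
next
  case (Node f)
  show ?case
    by (simp add: cop_sum_Node cop_sum_add Node.IH add.assoc)
next
  case (plus f g)
  have "cop_sum (f + g) (\<lambda>u z. cop_sum u (\<lambda>x y. F x y z))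
      = cop_sum f (\<lambda>u z. cop_sum g (\<lambda>u' z'. cop_sum u (\<lambda>x y. cop_sum u' (\<lambda>x' y'. F (x + x') (y + y') (z + z')))))"
    by (simp add: cop_sum_plus)
  also have "\<dots> = cop_sum f (\<lambda>u z. cop_sum u (\<lambda>x y. cop_sum g (\<lambda>u' z'. cop_sum u' (\<lambda>x' y'. F (x + x') (y + y') (z + z')))))"
    by (subst cop_sum_swap) (rule refl)
  also have "\<dots> = cop_sum f (\<lambda>x u. cop_sum u (\<lambda>y z. cop_sum g (\<lambda>x' u'. cop_sum u' (\<lambda>y' z'. F (x + x') (y + y') (z + z')))))"
    by (simp add: plus.IH)
  also have "\<dots> = cop_sum f (\<lambda>x u. cop_sum g (\<lambda>x' u'. cop_sum u (\<lambda>y z. cop_sum u' (\<lambda>y' z'. F (x + x') (y + y') (z + z')))))"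
    by (subst cop_sum_swap) (rule refl)
  also have "\<dots> = cop_sum (f + g) (\<lambda>x u. cop_sum u (\<lambda>y z. F x y z))"
    by (simp add: cop_sum_plus)
  finally show ?case .
qed

text \<open>Regroups four tensor factors so that the middle two come from one forest
  \<open>t\<close>; a convolution product on them can then be evaluated first.\<close>

lemma cop_sum_coassoc4:
  "cop_sum f (\<lambda>x y. cop_sum x (\<lambda>x1 x2. cop_sum y (\<lambda>y1 y2. F x1 x2 y1 y2)))
    = cop_sum f (\<lambda>x1 u. cop_sum u (\<lambda>t y2. cop_sum t (\<lambda>x2 y1. F x1 x2 y1 y2)))"
  by (simp only: cop_sum_coassoc)

definition eps :: "forest \<Rightarrow> rat" where
  "eps f = (if f = {#} then 1 else 0)"

lemma eps_empty [simp]: "eps {#} = 1"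
  and eps_nonempty [simp]: "f \<noteq> {#} \<Longrightarrow> eps f = 0"
  and eps_plus: "eps (f + g) = eps f * eps g"
  by (simp_all add: eps_def)

lemma cop_sum_zero [simp]: "cop_sum f (\<lambda>x y. 0) = 0"
  by (simp add: cop_sum_def lsum_def)

lemma cop_sum_scal: "cop_sum f (\<lambda>x y. scal c (F x y)) = scal c (cop_sum f F)"
  by (simp add: cop_sum_def lsum_scal)

lemma cop_sum_counit_left: "cop_sum f (\<lambda>x y. scal (eps x) (F y)) = F f"
proof (induction f arbitrary: F rule: forest_induct)
  case (plus f g)
  have "cop_sum (f + g) (\<lambda>x y. scal (eps x) (F y))
     = cop_sum f (\<lambda>x y. scal (eps x) (cop_sum g (\<lambda>x' y'. scal (eps x') (F (y + y')))))"
    by (simp add: cop_sum_plus eps_plus flip: cop_sum_scal)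
  then show ?case by (simp add: plus.IH)
qed (simp_all add: cop_sum_Node)

lemma cop_sum_counit_right: "cop_sum f (\<lambda>x y. scal (eps y) (F x)) = F f"
proof (induction f arbitrary: F rule: forest_induct)
  case (plus f g)
  have "cop_sum (f + g) (\<lambda>x y. scal (eps y) (F x))
     = cop_sum f (\<lambda>x y. scal (eps y) (cop_sum g (\<lambda>x' y'. scal (eps y') (F (x + x')))))"
    by (simp add: cop_sum_plus eps_plus flip: cop_sum_scal)
  then show ?case by (simp add: plus.IH)
qed (simp_all add: cop_sum_Node)

section \<open>Elements over valid words, and induction along generators\<close>

lemma inA_zero [simp]: "inA r 0"
  by (simp add: inA_def)

lemma inA_one [simp]: "inA r 1"
  by (simp add: inA_def valid_word_def zero_list_def)

lemma inA_add [simp]: "inA r p \<Longrightarrow> inA r q \<Longrightarrow> inA r (p + q)"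
  using Poly_Mapping.keys_add [of p q] by (auto simp: inA_def)

lemma inA_scal [simp]: "inA r p \<Longrightarrow> inA r (scal c p)"
  by (auto simp: inA_def in_keys_iff)

lemma inA_minus [simp]: "inA r p \<Longrightarrow> inA r (- p)"
  by (simp add: inA_def)

lemma inA_diff [simp]: "inA r p \<Longrightarrow> inA r q \<Longrightarrow> inA r (p - q)"
  using inA_add [of r p "- q"] by simp

lemma inA_times [simp]: "inA r p \<Longrightarrow> inA r q \<Longrightarrow> inA r (p * q)"
  using keys_mult [of p q] by (fastforce simp: inA_def valid_word_def plus_list_def)

lemma inA_power [simp]: "inA r p \<Longrightarrow> inA r (p ^ n)"
  by (induction n) simp_all

lemma inA_sum: "(\<And>i. i \<in> I \<Longrightarrow> inA r (F i)) \<Longrightarrow> inA r (sum F I)"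
  by (induction I rule: infinite_finite_induct) simp_all

lemma inA_lsum: "(\<And>k. k \<in> Poly_Mapping.keys p \<Longrightarrow> inA r (F k)) \<Longrightarrow> inA r (lsum p F)"
  unfolding lsum_def by (rule inA_sum) simp

lemma inA_cop_sum: "(\<And>x y. inA r (F x y)) \<Longrightarrow> inA r (cop_sum f F)"
  unfolding cop_sum_def by (rule inA_lsum)

lemma inA_zd [simp]: "s ^ r = 1 \<Longrightarrow> inA r (zd s)"
  unfolding zd_def by (rule inA_add) (auto simp: xx_def yy_def gen_def inA_def valid_word_def in_keys_iff
      lookup_single when_def split: if_splits)

lemma inA_zz [simp]: "inA r zz"
  unfolding zz_def by (rule inA_add) (auto simp: xx_def yy_def gen_def inA_def valid_word_def)

definition is_generator :: "nat \<Rightarrow> alg \<Rightarrow> bool" where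
  "is_generator r v \<longleftrightarrow> v = zz \<or> (\<exists>s. s ^ r = 1 \<and> v = zd s)"

lemma is_generator_zz [simp]: "is_generator r zz"
  and is_generator_zd [simp]: "s ^ r = 1 \<Longrightarrow> is_generator r (zd s)"
  by (auto simp: is_generator_def)

lemma inA_generator: "is_generator r v \<Longrightarrow> inA r v"
  by (auto simp: is_generator_def)

lemma gen_LX: "gen LX = zd 1"
  by (simp add: zd_def xx_def delta_def)

lemma gen_LY: "gen (LY s) = (if s = 1 then zz - zd 1 else zd s - zd 1)"
  by (simp add: zd_def zz_def xx_def yy_def delta_def)

text \<open>Every letter is a generator or a difference of two: x is \<open>zd 1\<close>, y_1 is
  \<open>zz - zd 1\<close>, and any other y_s is \<open>zd s - zd 1\<close>. Words grow on the right
  because the product rule for the maps splits off a generator there.\<close>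

lemma inA_induct [consumes 1, case_names one add scal times]:
  assumes "inA r p"
    and one: "P 1"
    and add: "\<And>p q. P p \<Longrightarrow> P q \<Longrightarrow> P (p + q)"
    and scal: "\<And>c p. P p \<Longrightarrow> P (scal c p)"
    and times: "\<And>p v. inA r p \<Longrightarrow> P p \<Longrightarrow> is_generator r v \<Longrightarrow> P (p * v)"
  shows "P p"
proof -
  have diff: "P (p - q)" if "P p" "P q" for p q
    using add [OF that(1) scal [OF that(2), of "- 1"]] by (simp add: scal_minus_one)
  have word: "P (Poly_Mapping.single w 1) \<and> inA r (Poly_Mapping.single w 1)" if "valid_word r w" for w
    using that
  proof (induction w rule: rev_induct)
    case Nil
    show ?case using one inA_one [of r] by (simp add: zero_list_def flip: single_one)
  next
    case (snoc l w)
    then have IH: "P (Poly_Mapping.single w 1)" "inA r (Poly_Mapping.single w 1)"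
      by (simp_all add: valid_word_def)
    have P: "P (Poly_Mapping.single w 1 * v)" if "is_generator r v" for v
      using times IH that by blast
    have "P (Poly_Mapping.single w 1 * gen l)"
    proof (cases l)
      case LX
      then show ?thesis using P [of "zd 1"] by (simp add: gen_LX)
    next
      case (LY s)
      then have "s ^ r = 1" using snoc.prems by (simp add: valid_word_def)
      then show ?thesis
        using P [of "zd 1"] P [of "zd s"] P [of zz] LY
        by (auto simp: gen_LY right_diff_distrib intro: diff)
    qed
    moreover have "Poly_Mapping.single w 1 * gen l = Poly_Mapping.single (w @ [l]) 1"
      by (simp add: gen_def mult_single plus_list_def)
    moreover have "inA r (Poly_Mapping.single (w @ [l]) 1)"
      using snoc.prems by (simp add: inA_def)
    ultimately show ?case by simp
  qed
  have zero: "P 0" using scal [OF one, of 0] by simp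
  have "P (\<Sum>w\<in>A. scal (Poly_Mapping.lookup p w) (Poly_Mapping.single w 1))"
    if "A \<subseteq> Poly_Mapping.keys p" for A
    using that
  proof (induction A rule: infinite_finite_induct)
    case (insert w A)
    then have "valid_word r w" using assms(1) by (simp add: inA_def)
    then show ?case
      using insert add [OF scal] word by (simp del: scal_single)
  qed (simp_all add: zero)
  from this [of "Poly_Mapping.keys p"] show ?thesis
    using lsum_singles [of p] by (simp add: lsum_def del: scal_single)
qed

section \<open>The anti-automorphism \<open>tau\<close>\<close>

lemma tau_eq_lsum: "tau p = lsum p tau_word"
  by (simp add: tau_def lsum_def)

lemma qlin_tau: "qlin tau"
  using qlin_lsum_left [of tau_word] by (simp flip: tau_eq_lsum)

lemma tau_word_append: "tau_word (v @ w) = tau_word w * tau_word v"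
  by (simp add: tau_word_def mult_single plus_list_def mult.commute)

lemma tau_times: "tau (p * q) = tau q * tau p"
proof -
  have "tau q * tau p = lsum q (\<lambda>b. lsum p (\<lambda>a. tau_word b * tau_word a))"
    unfolding tau_eq_lsum
    by (simp add: qlin_lsum [OF qlin_times_left] qlin_lsum [OF qlin_times_right] lsum_swap [of p])
  also have "\<dots> = lsum p (\<lambda>a. lsum q (\<lambda>b. tau_word (a + b)))"
    by (subst lsum_swap) (simp add: plus_list_def tau_word_append)
  finally show ?thesis by (simp add: tau_eq_lsum lsum_times)
qed

lemma tau_one [simp]: "tau 1 = 1"
  by (simp add: tau_eq_lsum tau_word_def zero_list_def flip: single_one)

lemma tau_gen: "tau (gen l) = scal (tau_sign l) (gen (tau_letter l))"
  by (simp add: tau_eq_lsum gen_def tau_word_def)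

lemma tau_zz [simp]: "tau zz = zz"
  by (simp add: zz_def xx_def yy_def qlin_add [OF qlin_tau] tau_gen add.commute)

lemma tau_zd [simp]: "tau (zd s) = zz - zd s"
  by (simp add: zd_def zz_def xx_def yy_def delta_def qlin_add [OF qlin_tau] qlin_scal [OF qlin_tau]
      tau_gen scal_minus_one)

lemma tau_zz_power [simp]: "tau (zz ^ n) = zz ^ n"
  by (induction n) (simp_all add: tau_times power_commutes)

lemma inA_tau [simp]: "inA r p \<Longrightarrow> inA r (tau p)"
proof (induction rule: inA_induct)
  case (times p v)
  then have "inA r (tau v)" by (auto simp: is_generator_def)
  with times show ?case by (simp add: tau_times)
qed (simp_all add: qlin_add [OF qlin_tau] qlin_scal [OF qlin_tau])

section \<open>Cancelling a right factor \<open>zz - zd s\<close>\<close>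

lemma lookup_times_gen:
  "Poly_Mapping.lookup (p * gen l) (w @ [m]) = (if l = m then Poly_Mapping.lookup p w else 0)"
  by (simp add: times_eq_lsum [of p] gen_def lsum_def lookup_sum lookup_single when_def
      plus_list_def in_keys_iff)

text \<open>Every \<open>z - z\<^sub>s\<^sup>\<delta>\<close> contains \<open>y\<^sub>1\<close> with coefficient 1, so a right factor of this form
  can be removed by reading off the words ending in \<open>y\<^sub>1\<close>.\<close>
lemma lookup_times_zz_minus_zd:
  "Poly_Mapping.lookup (p * (zz - zd s)) (w @ [LY 1]) = Poly_Mapping.lookup p w"
proof -
  have "zz - zd s = gen (LY 1) - scal (delta s) (gen (LY s))"
    by (simp add: zz_def zd_def yy_def)
  then show ?thesis
    by (simp add: right_diff_distrib scal_mult_right lookup_minus lookup_times_gen delta_def)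
qed

lemma zz_minus_zd_cancel_right:
  assumes "p * (zz - zd s) = q * (zz - zd s)"
  shows "p = q"
proof (rule poly_mapping_eqI)
  fix w
  show "Poly_Mapping.lookup p w = Poly_Mapping.lookup q w"
    using lookup_times_zz_minus_zd [of p s w] lookup_times_zz_minus_zd [of q s w] assms by simp
qed

text \<open>A word \<open>w\<close> of \<open>p\<close> reappears in the product followed by y_1, so
  its letters are valid. This keeps the quotient in the grafting rule inside the algebra.\<close>

lemma inA_cancel_right:
  assumes "inA r (p * (zz - zd s))"
  shows "inA r p"
  unfolding inA_def
proof
  fix w assume "w \<in> Poly_Mapping.keys p"
  then have "w @ [LY 1] \<in> Poly_Mapping.keys (p * (zz - zd s))"
    by (simp add: in_keys_iff lookup_times_zz_minus_zd)
  then have "valid_word r (w @ [LY 1])" using assms by (auto simp: inA_def)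
  then show "valid_word r w" by (simp add: valid_word_def)
qed

section \<open>Leaf signs and weights of forests\<close>

primrec leaf_sign_tree :: "tree \<Rightarrow> rat" where
  "leaf_sign_tree (Node f) = (if f = {#} then - 1 else prod_mset (image_mset leaf_sign_tree f))"

definition leaf_sign :: "forest \<Rightarrow> rat" where
  "leaf_sign f = prod_mset (image_mset leaf_sign_tree f)"

lemma leaf_sign_plus: "leaf_sign (f + g) = leaf_sign f * leaf_sign g"
  by (simp add: leaf_sign_def)

lemma leaf_sign_Node: "leaf_sign {#Node f#} = (if f = {#} then - 1 else leaf_sign f)"
  by (simp add: leaf_sign_def)

text \<open>The value 0 at the empty forest drops the term of the recursion that would repeat the
  value being expanded. On all other forests the truncated exponent is exact.\<close>

definition weight :: "forest \<Rightarrow> alg" where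
  "weight f = (if f = {#} then 0 else scal (leaf_sign f) (zz ^ (forest_size f - 1)))"

lemma weight_empty [simp]: "weight {#} = 0"
  by (simp add: weight_def)

text \<open>A new root over a nonempty forest adds a vertex but no leaf, hence the factor
  \<open>zz\<close>; over the empty forest it is itself a leaf, hence the counit term.\<close>

lemma weight_Node: "weight {#Node f#} = weight f * zz - scal (eps f) 1"
proof (cases "f = {#}")
  case False
  then obtain n where "forest_size f = Suc n"
    by (cases "forest_size f") auto
  with False show ?thesis
    by (simp add: weight_def leaf_sign_Node scal_mult_left power_commutes)
qed (simp add: weight_def leaf_sign_Node scal_minus_one)

text \<open>The middle \<open>zz\<close> makes up for one of the two lowered exponents. All powers
  of \<open>zz\<close> commute; the factor of \<open>g\<close> stands first to suit the inner sum
  over the second forest in \<open>T_zd_expansion\<close>.\<close>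

lemma weight_plus:
  assumes "f \<noteq> {#}" "g \<noteq> {#}"
  shows "weight (f + g) = weight g * zz * weight f"
proof -
  obtain m n where mn: "forest_size f = Suc m" "forest_size g = Suc n"
    using assms by (metis forest_size_eq_0_iff not0_implies_Suc)
  have "zz ^ Suc (m + n) = zz ^ n * zz * zz ^ m"
    using power_add [of zz n "Suc m"] by (simp add: mult.assoc add.commute)
  with mn assms show ?thesis
    by (simp add: weight_def leaf_sign_plus scal_mult_left scal_mult_right
      mult.commute [of "leaf_sign f"])
qed

lemma weight_plus_eps:
  "weight (f + g) = scal (eps g) (weight f) + scal (eps f) (weight g) + weight g * zz * weight f"
  by (cases "f = {#}"; cases "g = {#}") (simp_all add: weight_plus)

lemma inA_weight [simp]: "inA r (weight f)"
  by (simp add: weight_def)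

lemma tau_weight [simp]: "tau (weight f) = weight f"
  by (simp add: weight_def qlin_zero [OF qlin_tau] qlin_scal [OF qlin_tau])

section \<open>Rooted tree maps as a module algebra action\<close>

locale rooted_tree_maps =
  fixes r :: nat and T :: "forest \<Rightarrow> alg \<Rightarrow> alg"
  assumes rtm: "is_rtm r T"
begin

lemma qlin_T: "qlin (T f)"
  using rtm by (simp add: is_rtm_def qlin_def)

lemma T_empty [simp]: "T {#} w = w"
  using rtm by (simp add: is_rtm_def)

lemma T_one: "T f 1 = scal (eps f) 1"
  using rtm by (cases "f = {#}") (simp_all add: is_rtm_def aone_eq_one)

lemma T_bullet_zd: "s ^ r = 1 \<Longrightarrow> T {#Node {#}#} (zd s) = zd s * (zz - zd s)"
  using rtm by (simp add: is_rtm_def amul_eq_times bullet_def)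

lemma T_Node_zd:
  assumes "f \<noteq> {#}" "s ^ r = 1"
  obtains q where "T f (zd s) = q * (zz - zd s)"
    "T {#Node f#} (zd s) = q * (zz + zz - zd s) * (zz - zd s)"
proof -
  have "\<forall>f s. f \<noteq> {#} \<longrightarrow> s ^ r = 1 \<longrightarrow> (\<exists>q. T f (zd s) = q * (zz - zd s) \<and>
      T {#Node f#} (zd s) = q * (zz + zz - zd s) * (zz - zd s))"
    using rtm unfolding is_rtm_def amul_eq_times Bplus_def by (elim conjE)
  with assms that show thesis by blast
qed

lemma T_plus_generator:
  assumes "is_generator r v"
  shows "T (f + g) v = T f (T g v)"
proof (cases "f = {#} \<or> g = {#}")
  case False
  have "\<forall>g h. g \<noteq> {#} \<longrightarrow> h \<noteq> {#} \<longrightarrow> T (g + h) zz = T g (T h zz) \<and>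
      (\<forall>s. s ^ r = 1 \<longrightarrow> T (g + h) (zd s) = T g (T h (zd s)))"
    using rtm unfolding is_rtm_def by (elim conjE)
  with False assms show ?thesis by (auto simp: is_generator_def)
qed auto

lemma T_zz: "T f zz = scal (eps f) zz"
proof (induction f rule: forest_induct)
  case (Node f)
  then show ?case
    using rtm by (cases "f = {#}") (simp_all add: is_rtm_def Bplus_def bullet_def)
next
  case (plus f g)
  then show ?case by (simp add: T_plus_generator eps_plus qlin_zero [OF qlin_T])
qed simp

lemma T_times_generator:
  assumes "inA r w" "is_generator r v"
  shows "T f (w * v) = cop_sum f (\<lambda>x y. T x w * T y v)"
proof (cases "f = {#}")
  case False
  have "\<forall>f w v. f \<noteq> {#} \<longrightarrow> inA r w \<longrightarrow> is_generator r v \<longrightarrow>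
      T f (w * v) = cop_sum f (\<lambda>x y. T x w * T y v)"
    using rtm unfolding is_rtm_def is_generator_def cop_sum_def lsum_def amul_eq_times
    by (elim conjE)
  with False assms show ?thesis by blast
qed simp

text \<open>The product rule is given only for a generator on the right; coassociativity lets an
  arbitrary right factor be built up one generator at a time.\<close>

lemma T_times:
  assumes "inA r w" "inA r u"
  shows "T f (w * u) = cop_sum f (\<lambda>x y. T x w * T y u)"
  using assms(2)
proof (induction arbitrary: f rule: inA_induct)
  case one
  then show ?case by (simp add: T_one scal_mult_right cop_sum_counit_right)
next
  case (add p q)
  then show ?case by (simp add: qlin_add [OF qlin_T] distrib_left cop_sum_add)
next
  case (scal c p)
  then show ?case by (simp add: qlin_scal [OF qlin_T] scal_mult_right cop_sum_scal)
next
  case (times u v)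
  have "T f (w * (u * v)) = cop_sum f (\<lambda>x y. T x (w * u) * T y v)"
    using T_times_generator [of "w * u" v f] assms(1) times.hyps by (simp add: mult.assoc)
  also have "\<dots> = cop_sum f (\<lambda>x z. cop_sum x (\<lambda>x y. T x w * T y u * T z v))"
    by (simp add: times.IH cop_sum_mult_right)
  also have "\<dots> = cop_sum f (\<lambda>x y. T x w * T y (u * v))"
    using times.hyps by (simp add: cop_sum_coassoc T_times_generator cop_sum_mult_left mult.assoc)
  finally show ?case .
qed

text \<open>In a product of nonempty forests the inner map leads away from the generators, but both
  forests are strictly smaller, so the outer hypothesis covers arbitrary arguments. The product rule
  then passes from generators to words within the same size bound.\<close>

lemma inA_T_bounded:
  "forest_size f \<le> n \<Longrightarrow> inA r w \<Longrightarrow> inA r (T f w)"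
proof (induction n arbitrary: f w)
  case 0
  then show ?case by simp
next
  case (Suc n)
  have gen: "inA r (T f v)" if v: "is_generator r v" and f: "forest_size f \<le> Suc n" for f v
  proof -
    have zd: "inA r (T f (zd s))" if s: "s ^ r = 1" for s
      using f
    proof (induction f rule: forest_induct)
      case empty
      show ?case using s by simp
    next
      case (Node f)
      show ?case
      proof (cases "f = {#}")
        case True
        then show ?thesis using s by (simp add: T_bullet_zd)
      next
        case False
        from T_Node_zd [OF False s] obtain q where q: "T f (zd s) = q * (zz - zd s)"
          "T {#Node f#} (zd s) = q * (zz + zz - zd s) * (zz - zd s)" .
        have "inA r q"
          by (rule inA_cancel_right [of r q s]) (use Node q in simp)
        with q s show ?thesis by simp
      qed
    next
      case (plus f g)
      have "0 < forest_size f" "0 < forest_size g"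
        using plus.hyps by (auto simp: neq0_conv [symmetric] simp del: neq0_conv)
      then show ?case
        using plus.prems s by (simp add: T_plus_generator Suc.IH)
    qed
    with v show ?thesis by (auto simp: is_generator_def T_zz)
  qed
  from Suc.prems(2) show ?case
    using Suc.prems(1)
  proof (induction arbitrary: f rule: inA_induct)
    case one
    then show ?case by (simp add: T_one)
  next
    case (add p q)
    then show ?case by (simp add: qlin_add [OF qlin_T])
  next
    case (scal c p)
    then show ?case by (simp add: qlin_scal [OF qlin_T])
  next
    case (times w v)
    show ?case
      unfolding T_times_generator [OF times.hyps(1,2)] cop_sum_def
    proof (rule inA_lsum)
      fix k assume "k \<in> Poly_Mapping.keys (cop_forest f)"
      then have "forest_size (fst k) \<le> Suc n" "forest_size (snd k) \<le> Suc n"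
        using cop_forest_keys_size [of k f] times.prems by simp_all
      then show "inA r (T (fst k) w * T (snd k) v)"
        using times.IH gen times.hyps(2) by simp
    qed
  qed
qed

lemma inA_T [simp]: "inA r w \<Longrightarrow> inA r (T f w)"
  by (rule inA_T_bounded) (rule order.refl)

text \<open>Composition is prescribed on generators only. It extends to products because the
  coproduct is multiplicative.\<close>

lemma T_plus: "inA r w \<Longrightarrow> T (f + g) w = T f (T g w)"
proof (induction arbitrary: f g rule: inA_induct)
  case one
  then show ?case by (simp add: T_one qlin_scal [OF qlin_T] eps_plus mult.commute)
next
  case (add p q)
  then show ?case by (simp add: qlin_add [OF qlin_T])
next
  case (scal c p)
  then show ?case by (simp add: qlin_scal [OF qlin_T])
next
  case (times w v)
  have v: "inA r v" using times.hyps(2) by (rule inA_generator)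
  have "T (f + g) (w * v) = cop_sum f (\<lambda>x y. cop_sum g (\<lambda>x' y'. T x (T x' w) * T y (T y' v)))"
    using times by (simp add: T_times_generator cop_sum_plus T_plus_generator)
  also have "\<dots> = cop_sum g (\<lambda>x' y'. T f (T x' w * T y' v))"
    using times.hyps(1) v by (subst cop_sum_swap) (simp add: T_times)
  also have "\<dots> = T f (T g (w * v))"
    using times.hyps by (simp add: T_times_generator qlin_cop_sum [OF qlin_T])
  finally show ?case .
qed

text \<open>Nonempty forests annihilate \<open>zz\<close>, so the counit law collapses the product
  rule. Hence powers of \<open>zz\<close>, and with them all weights, pass through every map on the
  right.\<close>

lemma T_times_zz:
  assumes "inA r w"
  shows "T f (w * zz) = T f w * zz"
proof -
  have "T f (w * zz) = cop_sum f (\<lambda>x y. scal (eps y) (T x w * zz))"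
    using assms by (simp add: T_times T_zz scal_mult_right)
  then show ?thesis by (simp only: cop_sum_counit_right)
qed

lemma T_times_zz_power: "inA r w \<Longrightarrow> T f (w * zz ^ n) = T f w * zz ^ n"
  by (induction n) (simp_all add: power_Suc2 T_times_zz flip: mult.assoc del: power_Suc)

lemma T_times_weight: "inA r w \<Longrightarrow> T f (w * weight g) = T f w * weight g"
  by (simp add: weight_def scal_mult_right T_times_zz_power qlin_scal [OF qlin_T] qlin_zero [OF qlin_T])

section \<open>The closed recursion on the generators \<open>zd s\<close>\<close>

text \<open>For a tree, the hypothesis for the forest below the root and cancellation of
  \<open>b\<close> identify the quotient in the grafting rule as \<open>- X g\<close>. For a product
  \<open>g + h\<close>, the map \<open>T g\<close> is applied to
  \<open>T h a = - (X h * b)\<close>.\<close>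

lemma T_zd_expansion:
  assumes s: "s ^ r = 1"
  shows "T f (zd s) = scal (eps f) (zd s) - cop_sum f (\<lambda>x y. T x (zd s) * weight y) * (zz - zd s)"
proof (induction "forest_size f" arbitrary: f rule: less_induct)
  case less
  define a where "a = zd s"
  define b where "b = zz - a"
  define X where "X f = cop_sum f (\<lambda>x y. T x a * weight y)" for f
  have IH: "T g a = scal (eps g) a - X g * b" if "forest_size g < forest_size f" for g
    using less that by (simp add: a_def b_def X_def)
  have [simp]: "inA r a" using s by (simp add: a_def)
  have [simp]: "inA r (X g)" for g unfolding X_def by (rule inA_cop_sum) simp
  have "T f a = scal (eps f) a - X f * b"
  proof (cases f rule: forest_cases)
    case empty
    then show ?thesis by (simp add: X_def)
  next
    case (Node g)
    \<comment> \<open>The term with the whole tree on the left has weight 0; the counit term of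
      \<open>weight_Node\<close> produces \<open>T g a\<close>.\<close>
    have X: "X f = X g * zz - T g a"
      by (simp add: Node X_def cop_sum_Node weight_Node right_diff_distrib cop_sum_diff scal_mult_right
          cop_sum_counit_right cop_sum_mult_right mult.assoc)
    show ?thesis
    proof (cases "g = {#}")
      case True
      then show ?thesis using s Node X by (simp add: X_def T_bullet_zd a_def b_def)
    next
      case False
      from T_Node_zd [OF False s] obtain q where q: "T g a = q * b" "T {#Node g#} a = q * (zz + b) * b"
        unfolding a_def b_def by (metis add_diff_eq)
      have "q * b = - X g * b"
        using IH [of g] Node False q(1) by simp
      then have "q = - X g"
        unfolding a_def b_def by (rule zz_minus_zd_cancel_right)
      with q X Node show ?thesis by (simp add: algebra_simps)
    qed
  next
    case (plus g h)
    have size: "0 < forest_size g" "0 < forest_size h"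
      using plus by (auto simp: neq0_conv [symmetric] simp del: neq0_conv)
    have Th: "T h a = - (X h * b)"
      using IH [of h] plus size by simp
    have zz: "zz = a + b" by (simp add: b_def)
    have Xf: "X f = T g (X h) + cop_sum g (\<lambda>x y. T x (X h * a) * weight y)"
    proof -
      have "cop_sum h (\<lambda>x' y'. T (x + x') a * weight (y + y'))
          = scal (eps y) (T x (X h)) + T x (X h * a) * weight y" for x y
      proof -
        have "cop_sum h (\<lambda>x' y'. T (x + x') a * weight (y + y'))
            = cop_sum h (\<lambda>x' y'. scal (eps y') (T x (T x' a) * weight y))
              + scal (eps y) (cop_sum h (\<lambda>x' y'. T x (T x' a) * weight y'))
              + cop_sum h (\<lambda>x' y'. T x (T x' a) * weight y') * zz * weight y"
          by (simp add: T_plus weight_plus_eps distrib_left scal_mult_right cop_sum_add cop_sum_scal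
              cop_sum_mult_right mult.assoc)
        also have "cop_sum h (\<lambda>x' y'. T x (T x' a) * weight y') = T x (X h)"
          by (simp add: X_def qlin_cop_sum [OF qlin_T] T_times_weight)
        also have "cop_sum h (\<lambda>x' y'. scal (eps y') (T x (T x' a) * weight y)) = T x (T h a) * weight y"
          by (rule cop_sum_counit_right)
        \<comment> \<open>Splitting \<open>zz\<close> as \<open>a + b\<close> turns
          \<open>X h * b\<close> into \<open>- T h a\<close>, which cancels the counit term
          containing \<open>T x (T h a)\<close>.\<close>
        also have "T x (X h) * zz * weight y = T x (X h * a) * weight y - T x (T h a) * weight y"
        proof -
          have "T x (X h) * zz = T x (X h * a) - T x (T h a)"
            by (simp flip: T_times_zz qlin_diff [OF qlin_T]) (simp add: Th zz distrib_left)
          then show ?thesis by (simp add: left_diff_distrib)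
        qed
        finally show ?thesis by simp
      qed
      then show ?thesis
        by (simp add: plus X_def [of "g + h"] cop_sum_plus cop_sum_add cop_sum_counit_right)
    qed
    \<comment> \<open>The product rule and coassociativity turn the weighted sum into
      \<open>X y * b\<close>. The hypothesis then applies, since \<open>y\<close> is no larger than
      \<open>g\<close> and \<open>g\<close> is smaller than \<open>f\<close>.\<close>
    have "cop_sum g (\<lambda>x y. T x (w * a) * weight y) * b = cop_sum g (\<lambda>x y. T x w * (X y * b))"
      if "inA r w" for w
      using that by (simp add: T_times cop_sum_mult_right X_def cop_sum_coassoc cop_sum_mult_left mult.assoc)
    then have "cop_sum g (\<lambda>x y. T x (X h * a) * weight y) * b
        = cop_sum g (\<lambda>x y. T x (X h) * (X y * b))" by simp
    also have "\<dots> = cop_sum g (\<lambda>x y. T x (X h) * (scal (eps y) a - T y a))"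
    proof (rule cop_sum_cong_size)
      fix x y assume "forest_size x + forest_size y = forest_size g"
      then have "X y * b = scal (eps y) a - T y a"
        using IH [of y] plus size by simp
      then show "T x (X h) * (X y * b) = T x (X h) * (scal (eps y) a - T y a)" by simp
    qed
    also have "\<dots> = T g (X h) * a - T g (X h * a)"
      by (simp add: right_diff_distrib cop_sum_diff scal_mult_right cop_sum_counit_right T_times)
    finally have "X f * b = T g (X h) * zz - T g (X h * a)"
      by (simp add: Xf zz distrib_right distrib_left)
    also have "\<dots> = T g (X h * b)"
      by (simp add: b_def right_diff_distrib qlin_diff [OF qlin_T] T_times_zz)
    finally show ?thesis
      using plus Th by (simp add: T_plus qlin_minus [OF qlin_T])
  qed
  then show ?case by (simp add: a_def b_def X_def)
qed

section \<open>The conjugated maps as a right convolution inverse\<close>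

definition T_conj :: "forest \<Rightarrow> alg \<Rightarrow> alg" where
  "T_conj f w = tau (T f (tau w))"

lemma qlin_T_conj: "qlin (T_conj f)"
  using qlin_T [of f] qlin_tau by (simp add: T_conj_def qlin_def)

lemma inA_T_conj [simp]: "inA r w \<Longrightarrow> inA r (T_conj f w)"
  by (simp add: T_conj_def)

text \<open>Since \<open>tau\<close> reverses products, the two tensor factors act in exchanged
  positions.\<close>

lemma T_conj_times:
  assumes "inA r w" "inA r u"
  shows "T_conj f (w * u) = cop_sum f (\<lambda>x y. T_conj y w * T_conj x u)"
  using assms by (simp add: T_conj_def tau_times T_times qlin_cop_sum [OF qlin_tau])

lemma T_conj_zd:
  assumes s: "s ^ r = 1"
  shows "T_conj f (zd s) = scal (eps f) (zd s) + zd s * weight f * zz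
     - cop_sum f (\<lambda>x y. zd s * weight y * T_conj x (zd s))"
proof -
  define a where "a = zd s"
  \<comment> \<open>As \<open>tau\<close> sends \<open>a\<close> to \<open>zz - a\<close> and
    \<open>T g\<close> acts on \<open>zz\<close> by the counit, \<open>T_conj g a\<close> and
    \<open>tau (T g a)\<close> determine each other.\<close>
  have conj: "T_conj g a = scal (eps g) zz - tau (T g a)" for g
    by (simp add: T_conj_def a_def qlin_diff [OF qlin_T] T_zz qlin_diff [OF qlin_tau] qlin_scal [OF qlin_tau])
  then have tau_T: "tau (T g a) = scal (eps g) zz - T_conj g a" for g
    by simp
  have "tau (T f a) = scal (eps f) (zz - a) - a * cop_sum f (\<lambda>x y. weight y * tau (T x a))"
    unfolding a_def by (subst T_zd_expansion [OF s])
      (simp add: qlin_diff [OF qlin_tau] qlin_scal [OF qlin_tau] tau_times qlin_cop_sum [OF qlin_tau])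
  also have "cop_sum f (\<lambda>x y. weight y * tau (T x a))
      = cop_sum f (\<lambda>x y. scal (eps x) (weight y * zz)) - cop_sum f (\<lambda>x y. weight y * T_conj x a)"
    by (simp add: tau_T right_diff_distrib cop_sum_diff scal_mult_right)
  also have "cop_sum f (\<lambda>x y. scal (eps x) (weight y * zz)) = weight f * zz"
    by (rule cop_sum_counit_left)
  finally have "T_conj f a = scal (eps f) zz - (scal (eps f) (zz - a)
      - a * (weight f * zz - cop_sum f (\<lambda>x y. weight y * T_conj x a)))"
    by (simp only: conj [of f])
  then show ?thesis
    by (simp add: a_def scal_diff_right right_diff_distrib cop_sum_mult_left mult.assoc)
qed

text \<open>Applying \<open>T x\<close> to the recursion for \<open>T_conj y\<close> gives
  \<open>T f a + X * zz\<close> minus a fourfold sum. By induction that sum is \<open>X * a\<close>,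
  and \<open>T_zd_expansion\<close> evaluates \<open>T f a + X * (zz - a)\<close>.\<close>

lemma T_T_conj_zd:
  assumes s: "s ^ r = 1"
  shows "cop_sum f (\<lambda>x y. T x (T_conj y (zd s))) = scal (eps f) (zd s)"
proof (induction "forest_size f" arbitrary: f rule: less_induct)
  case less
  define a where "a = zd s"
  have [simp]: "inA r a" using s by (simp add: a_def)
  define X where "X = cop_sum f (\<lambda>x y. T x a * weight y)"
  \<comment> \<open>Since \<open>weight y\<close> vanishes for empty \<open>y\<close>, the induction
    hypothesis is called only for \<open>t\<close> strictly smaller than \<open>f\<close>.\<close>
  have IH: "weight y * cop_sum t (\<lambda>x y. T x (T_conj y a)) = scal (eps t) (weight y * a)"
    if "forest_size t + forest_size y \<le> forest_size f" for t y
  proof (cases "y = {#}")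
    case False
    then have "0 < forest_size y" by (auto simp: neq0_conv [symmetric] simp del: neq0_conv)
    then show ?thesis
      using less [of t] that by (simp add: a_def scal_mult_right)
  qed simp
  have "T x (a * weight y2 * T_conj y1 a)
      = cop_sum x (\<lambda>x1 x2. T x1 a * weight y2 * T x2 (T_conj y1 a))" for x y1 y2
    by (subst T_times) (simp_all add: T_times_weight)
  then have "cop_sum f (\<lambda>x y. cop_sum y (\<lambda>y1 y2. T x (a * weight y2 * T_conj y1 a)))
      = cop_sum f (\<lambda>x y. cop_sum x (\<lambda>x1 x2. cop_sum y (\<lambda>y1 y2.
          T x1 a * weight y2 * T x2 (T_conj y1 a))))"
    by (subst cop_sum_swap) simp
  \<comment> \<open>The middle factors \<open>x2\<close> and \<open>y1\<close> are gathered into one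
    forest \<open>t\<close>, exposing the convolution that \<open>IH\<close> evaluates.\<close>
  also have "\<dots> = cop_sum f (\<lambda>x z. T x a * cop_sum z (\<lambda>t y. weight y * cop_sum t (\<lambda>x y. T x (T_conj y a))))"
    by (subst cop_sum_coassoc4) (simp add: cop_sum_mult_left mult.assoc)
  also have "\<dots> = cop_sum f (\<lambda>x z. T x a * cop_sum z (\<lambda>t y. scal (eps t) (weight y * a)))"
    by (intro cop_sum_cong_size arg_cong2 [of _ _ _ _ "(*)"] refl IH) simp
  also have "\<dots> = X * a"
    by (simp add: cop_sum_counit_left X_def cop_sum_mult_right mult.assoc)
  finally have quad: "cop_sum f (\<lambda>x y. cop_sum y (\<lambda>y1 y2. T x (a * weight y2 * T_conj y1 a))) = X * a" .
  have "T x (T_conj y a) = scal (eps y) (T x a) + T x a * weight y * zz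
      - cop_sum y (\<lambda>y1 y2. T x (a * weight y2 * T_conj y1 a))" for x y
    by (subst T_conj_zd [OF s, folded a_def])
      (simp add: qlin_add [OF qlin_T] qlin_diff [OF qlin_T] qlin_scal [OF qlin_T]
        qlin_cop_sum [OF qlin_T] T_times_zz T_times_weight)
  then have "cop_sum f (\<lambda>x y. T x (T_conj y a)) = T f a + X * zz
      - cop_sum f (\<lambda>x y. cop_sum y (\<lambda>y1 y2. T x (a * weight y2 * T_conj y1 a)))"
    by (simp add: cop_sum_diff cop_sum_add cop_sum_counit_right X_def cop_sum_mult_right)
  then have "cop_sum f (\<lambda>x y. T x (T_conj y a)) = T f a + X * (zz - a)"
    by (simp only: quad right_diff_distrib diff_add_eq_diff_diff_swap add_diff_eq)
  also have "\<dots> = scal (eps f) a"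
    using T_zd_expansion [OF s, of f] by (simp add: X_def a_def)
  finally show ?case by (simp add: a_def)
qed

lemma T_T_conj:
  "inA r w \<Longrightarrow> cop_sum f (\<lambda>x y. T x (T_conj y w)) = scal (eps f) w"
proof (induction arbitrary: f rule: inA_induct)
  case one
  have "T_conj y 1 = scal (eps y) 1" for y
    by (simp add: T_conj_def T_one qlin_scal [OF qlin_tau])
  then show ?case
    by (simp only: qlin_scal [OF qlin_T] cop_sum_counit_right T_one)
next
  case (add p q)
  then show ?case
    by (simp add: qlin_add [OF qlin_T] qlin_add [OF qlin_T_conj] cop_sum_add scal_add_right)
next
  case (scal c p)
  then show ?case
    by (simp add: qlin_scal [OF qlin_T] qlin_scal [OF qlin_T_conj] cop_sum_scal mult.commute)
next
  case (times w v)
  have v: "inA r v" using times.hyps(2) by (rule inA_generator)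
  have gen: "cop_sum t (\<lambda>x y. T x (T_conj y v)) = scal (eps t) v" for t
  proof -
    have "T_conj y zz = scal (eps y) zz" for y
      by (simp add: T_conj_def T_zz qlin_scal [OF qlin_tau])
    then have "cop_sum t (\<lambda>x y. T x (T_conj y zz)) = scal (eps t) zz"
      by (simp only: qlin_scal [OF qlin_T] cop_sum_counit_right T_zz)
    then show ?thesis
      using times.hyps(2) T_T_conj_zd [of _ t] by (auto simp: is_generator_def)
  qed
  have "cop_sum f (\<lambda>x y. T x (T_conj y (w * v)))
      = cop_sum f (\<lambda>x y. cop_sum x (\<lambda>x1 x2. cop_sum y (\<lambda>y1 y2.
          T x1 (T_conj y2 w) * T x2 (T_conj y1 v))))"
    using times.hyps(1) v
    by (subst cop_sum_swap) (simp add: T_conj_times qlin_cop_sum [OF qlin_T] T_times)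
  \<comment> \<open>Owing to the exchanged positions, the two middle factors both act on
    \<open>v\<close>: the convolution on \<open>v\<close> collapses first and leaves one on
    \<open>w\<close>.\<close>
  also have "\<dots> = cop_sum f (\<lambda>x z. cop_sum z (\<lambda>t y. T x (T_conj y w) * scal (eps t) v))"
    by (subst cop_sum_coassoc4) (simp add: gen flip: cop_sum_mult_left)
  also have "\<dots> = scal (eps f) (w * v)"
    by (simp add: scal_mult_right cop_sum_counit_left times.IH scal_mult_left flip: cop_sum_mult_right)
  finally show ?case .
qed

section \<open>Comparison with the antipode\<close>

lemma rtm_lin_eq_lsum: "rtm_lin T h w = lsum h (\<lambda>f. T f w)"
  by (simp add: rtm_lin_def lsum_def)

lemma qlin_rtm_lin_left: "qlin (\<lambda>h. rtm_lin T h w)"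
  unfolding rtm_lin_eq_lsum by (rule qlin_lsum_left)

lemma qlin_rtm_lin: "qlin (rtm_lin T h)"
  by (rule qlinI)
    (simp_all add: rtm_lin_eq_lsum qlin_add [OF qlin_T] qlin_scal [OF qlin_T] lsum_add lsum_scal)

lemma rtm_lin_times_forest:
  assumes "inA r w"
  shows "rtm_lin T (h * forest f) w = rtm_lin T h (T f w)"
  using assms by (simp add: rtm_lin_eq_lsum forest_def lsum_times T_plus)

lemma rtm_lin_antipode_forest:
  assumes S: "is_antipode S" and w: "inA r w"
  shows "rtm_lin T (S (forest f)) w = T_conj f w"
proof -
  \<comment> \<open>The antipode identity carries over to maps because \<open>rtm_lin\<close> turns
    right multiplication by a forest into composition.\<close>
  have left: "cop_sum g (\<lambda>x y. rtm_lin T (S (forest x)) (T y u)) = scal (eps g) u"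
    if "inA r u" for g u
  proof -
    have "m_S_id S (coproduct (forest g)) = scal (counit (forest g)) 1"
      using S by (simp add: is_antipode_def)
    then have "cop_sum g (\<lambda>x y. S (forest x) * forest y) = scal (eps g) 1"
      by (simp add: m_S_id_def coproduct_def forest_def counit_def lookup_single when_def eps_def
          cop_sum_def lsum_def)
    then have "rtm_lin T (cop_sum g (\<lambda>x y. S (forest x) * forest y)) u = scal (eps g) (rtm_lin T 1 u)"
      by (simp add: qlin_scal [OF qlin_rtm_lin_left])
    moreover have "rtm_lin T 1 u = u"
      by (simp add: rtm_lin_eq_lsum flip: single_one)
    ultimately show ?thesis
      using that by (simp add: qlin_cop_sum [OF qlin_rtm_lin_left] rtm_lin_times_forest)
  qed
  \<comment> \<open>Left and right convolution inverses agree: the counit is replaced by the left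
    inverse convolved with \<open>T\<close>, the sum is reassociated, and \<open>T\<close> cancels
    against \<open>T_conj\<close>.\<close>
  have "T_conj f w = cop_sum f (\<lambda>x y. scal (eps x) (T_conj y w))"
    by (rule cop_sum_counit_left [symmetric])
  also have "\<dots> = cop_sum f (\<lambda>t z. cop_sum t (\<lambda>x y. rtm_lin T (S (forest x)) (T y (T_conj z w))))"
    using w by (simp add: left)
  also have "\<dots> = cop_sum f (\<lambda>x t. rtm_lin T (S (forest x)) (cop_sum t (\<lambda>y z. T y (T_conj z w))))"
    by (simp add: cop_sum_coassoc qlin_cop_sum [OF qlin_rtm_lin])
  also have "\<dots> = rtm_lin T (S (forest f)) w"
    using w by (simp add: T_T_conj qlin_scal [OF qlin_rtm_lin] cop_sum_counit_right)
  finally show ?thesis ..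
qed

end

theorem mainTheorem4:
  fixes r :: nat and T :: "forest \<Rightarrow> alg \<Rightarrow> alg" and S :: "hopf \<Rightarrow> hopf"
  assumes "r \<ge> 1" and "is_rtm r T" and "is_antipode S"
  shows "\<forall>h v. inA r v \<longrightarrow> rtm_lin T (S h) v = (tau \<circ> rtm_lin T h \<circ> tau) v"
proof (intro allI impI)
  fix h v assume v: "inA r v"
  interpret rooted_tree_maps r T by standard (rule assms(2))
  have "qlin S" using assms(3) by (simp add: is_antipode_def qlin_def)
  \<comment> \<open>Linearity of the antipode reduces the claim to single forests.\<close>
  then have "S h = lsum h (\<lambda>f. S (forest f))"
    unfolding forest_def by (rule qlin_expand)
  then have "rtm_lin T (S h) v = lsum h (\<lambda>f. rtm_lin T (S (forest f)) v)"
    by (simp add: qlin_lsum [OF qlin_rtm_lin_left])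
  also have "\<dots> = tau (rtm_lin T h (tau v))"
    using v by (simp add: rtm_lin_antipode_forest [OF assms(3)] T_conj_def rtm_lin_eq_lsum [of h]
        qlin_lsum [OF qlin_tau])
  finally show "rtm_lin T (S h) v = (tau \<circ> rtm_lin T h \<circ> tau) v" by simp
qed

end
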